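(* Let $1\le n \le 8$. Every cycle in $G(n)$ is trivial: for every directed cycle (closed path) in $G(n)$, the product of the permutations along its edges is the identity. Hence there are no commutativity properties for double semigroups in degree $n\le 8$; that is, if $m$ and $m'$ are multilinear monomials of degree $n \le 8$ with the same association type which are joined by a directed path in $F(n)$, then $m=m'$ as monomials (they have the same permutation of the indeterminates).
   Context: A double semigroup is a set $S$ with two associative binary operations $\circ,\bullet$ satisfying the interchange relation $(a\bullet b)\circ(c\bullet d)=(a\circ c)\bullet(b\circ d)$ for all $a,b,c,d\in S$. No units are assumed. Association types of degree $n$: the possible placements of parentheses and operation symbols in a monomial with $n$ argument positions in two associative operations $\circ,\bullet$, considered modulo the two associative laws only (the interchange relation is not imposed). Equivalently: planar rooted trees with $n$ leaves in which every internal node has at least two children and is labelled $\circ$ or $\bullet$, with the labels alternating along every path from the root. A multilinear monomial of degree $n$ is an association type of degree $n$ whose positions, from left to right, are filled with a permutation of $n$ fixed indeterminates $a_1,\dots,a_n$. $F(n)$ is the directed graph whose vertices are the multilinear monomials of degree $n$, with an edge $m\to m'$ whenever $m'$ is obtained from $m$ by one application of the interchange relation: modulo the two associative laws, some submonomial of $m$ of the form $(w\bullet x)\circ(y\bullet z)$ is replaced by $(w\circ y)\bullet(x\circ z)$, or conversely, where $w,x,y,z$ are arbitrary monomials. So every edge has a reverse edge. The symmetric group $S_n$ acts freely on $F(n)$ by permuting the positions of the indeterminates; $G(n)$ is the quotient graph and $p\colon F(n)\to G(n)$ is the covering projection. The vertices of $G(n)$ are the association types of degree $n$. If an edge of $G(n)$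 is covered by an edge $m_i\to m_j$ of $F(n)$, where $m_i,m_j$ have underlying permutations $\sigma_i,\sigma_j$ of the indeterminates, then it is labelled by the permutation $\sigma_{ij}=\sigma_i^{-1}\sigma_j$ of positions (independent of the lift), and labels are composed along directed paths. A commutativity property in degree $n$ corresponds to a directed cycle (closed path) in $G(n)$ for which the product of the permutations along the edges is not the identity, equivalently a closed path some (hence any) lifting of which to $F(n)$ is not closed; such a cycle is called nontrivial, and otherwise trivial. *)

theory Defs
  imports "Graph_Theory.Arc_Walk" "HOL-Combinatorics.Permutations"
begin

section \<open>Monomials in two associative operations\<close>

datatype 'a mexp =
    Indet 'a
  | Circ "'a mexp" "'a mexp" (infixl "\<^bold>\<circ>" 70)
  | Bullet "'a mexp" "'a mexp" (infixl "\<^bold>\<bullet>" 70)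

inductive assoc_eq :: "'a mexp \<Rightarrow> 'a mexp \<Rightarrow> bool" (infix "\<approx>" 50) where
  assoc_Circ: "(x \<^bold>\<circ> y) \<^bold>\<circ> z \<approx> x \<^bold>\<circ> (y \<^bold>\<circ> z)"
| assoc_Bullet: "(x \<^bold>\<bullet> y) \<^bold>\<bullet> z \<approx> x \<^bold>\<bullet> (y \<^bold>\<bullet> z)"
| refl: "x \<approx> x"
| sym: "x \<approx> y \<Longrightarrow> y \<approx> x"
| trans: "x \<approx> y \<Longrightarrow> y \<approx> z \<Longrightarrow> x \<approx> z"
| cong_Circ: "x \<approx> x' \<Longrightarrow> y \<approx> y' \<Longrightarrow> x \<^bold>\<circ> y \<approx> x' \<^bold>\<circ> y'"
| cong_Bullet: "x \<approx> x' \<Longrightarrow> y \<approx> y' \<Longrightarrow> x \<^bold>\<bullet> y \<approx> x' \<^bold>\<bullet> y'"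

quotient_type 'a monomial = "'a mexp" / assoc_eq
  by (intro equivpI reflpI sympI transpI)
    (blast intro: assoc_eq.refl assoc_eq.sym assoc_eq.trans)+

primrec mexp_indets :: "'a mexp \<Rightarrow> 'a list" where
  "mexp_indets (Indet a) = [a]"
| "mexp_indets (x \<^bold>\<circ> y) = mexp_indets x @ mexp_indets y"
| "mexp_indets (x \<^bold>\<bullet> y) = mexp_indets x @ mexp_indets y"

lift_definition indets :: "'a monomial \<Rightarrow> 'a list" is mexp_indets
proof -
  show "mexp_indets s = mexp_indets t" if "s \<approx> t" for s t :: "'a mexp"
    using that by induction auto
qed

lift_definition rename :: "('a \<Rightarrow> 'b) \<Rightarrow> 'a monomial \<Rightarrow> 'b monomial" is map_mexp
proof -
  show "map_mexp f s \<approx> map_mexp f t" if "s \<approx> t" for f :: "'a \<Rightarrow> 'b" and s t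
    using that by induction (auto intro: assoc_eq.intros)
qed

definition degree :: "'a monomial \<Rightarrow> nat" where
  "degree m = length (indets m)"

text \<open>An association type is a monomial all of whose positions carry the same dummy symbol.\<close>

type_synonym association_type = "unit monomial"

definition assoc_type :: "'a monomial \<Rightarrow> association_type" where
  "assoc_type = rename (\<lambda>_. ())"

text \<open>The indeterminates \<open>a\<^sub>1, \<dots>, a\<^sub>n\<close> are represented by \<open>0, \<dots>, n - 1\<close>, and positions are
  likewise counted from \<open>0\<close>.\<close>

definition multilinear :: "nat \<Rightarrow> nat monomial \<Rightarrow> bool" where
  "multilinear n m \<longleftrightarrow> distinct (indets m) \<and> set (indets m) = {..<n}"

text \<open>The underlying permutation sends a position to the indeterminate standing there.\<close>

definition underlying_perm :: "nat monomial \<Rightarrow> nat \<Rightarrow> nat" where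
  "underlying_perm m = (\<lambda>k. if k < degree m then indets m ! k else k)"

section \<open>The graph \<open>F(n)\<close>\<close>

inductive interchange_mexp :: "'a mexp \<Rightarrow> 'a mexp \<Rightarrow> bool" where
  forward: "interchange_mexp ((w \<^bold>\<bullet> x) \<^bold>\<circ> (y \<^bold>\<bullet> z)) ((w \<^bold>\<circ> y) \<^bold>\<bullet> (x \<^bold>\<circ> z))"
| backward: "interchange_mexp ((w \<^bold>\<circ> y) \<^bold>\<bullet> (x \<^bold>\<circ> z)) ((w \<^bold>\<bullet> x) \<^bold>\<circ> (y \<^bold>\<bullet> z))"
| Circ_left: "interchange_mexp s s' \<Longrightarrow> interchange_mexp (s \<^bold>\<circ> t) (s' \<^bold>\<circ> t)"
| Circ_right: "interchange_mexp t t' \<Longrightarrow> interchange_mexp (s \<^bold>\<circ> t) (s \<^bold>\<circ> t')"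
| Bullet_left: "interchange_mexp s s' \<Longrightarrow> interchange_mexp (s \<^bold>\<bullet> t) (s' \<^bold>\<bullet> t)"
| Bullet_right: "interchange_mexp t t' \<Longrightarrow> interchange_mexp (s \<^bold>\<bullet> t) (s \<^bold>\<bullet> t')"

text \<open>Since any bracketing may be chosen to represent a monomial, the rewritten submonomial may
  consist of any consecutive factors of a longer product.\<close>

definition interchange :: "'a monomial \<Rightarrow> 'a monomial \<Rightarrow> bool" where
  "interchange m m' \<longleftrightarrow>
    (\<exists>s t. m = abs_monomial s \<and> m' = abs_monomial t \<and> interchange_mexp s t)"

definition F :: "nat \<Rightarrow> (nat monomial, nat monomial \<times> nat monomial) pre_digraph" where
  "F n = \<lparr> verts = {m. multilinear n m},
           arcs = {(m, m'). multilinear n m \<and> multilinear n m' \<and> interchange m m'},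
           tail = fst, head = snd \<rparr>"

section \<open>The quotient graph \<open>G(n)\<close>\<close>

text \<open>The symmetric group acts by renaming indeterminates, that is, \<open>\<tau>\<close> turns the underlying
  permutation \<open>\<sigma>\<close> into \<open>\<tau> \<circ> \<sigma>\<close>; this is the action which preserves the arcs of \<open>F(n)\<close> and leaves
  \<open>\<sigma>\<^sub>i\<^sup>-\<^sup>1 \<circ> \<sigma>\<^sub>j\<close> invariant. An arc of \<open>G(n)\<close> is an orbit of arcs of \<open>F(n)\<close>, so \<open>G(n)\<close> may have
  parallel arcs with different labels.\<close>

definition arc_orbit ::
    "nat \<Rightarrow> nat monomial \<times> nat monomial \<Rightarrow> (nat monomial \<times> nat monomial) set" where
  "arc_orbit n e = {(rename \<tau> (fst e), rename \<tau> (snd e)) | \<tau>. \<tau> permutes {..<n}}"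

text \<open>The arguments of \<open>the_elem\<close> below are singletons on all arcs, see \<open>arc_orbit_ends\<close> and
  \<open>arc_label_orbit\<close>.\<close>

definition G :: "nat \<Rightarrow> (association_type, (nat monomial \<times> nat monomial) set) pre_digraph" where
  "G n = \<lparr> verts = {T. degree T = n},
           arcs = arc_orbit n ` arcs (F n),
           tail = \<lambda>E. the_elem ((\<lambda>(m, m'). assoc_type m) ` E),
           head = \<lambda>E. the_elem ((\<lambda>(m, m'). assoc_type m') ` E) \<rparr>"

definition arc_label :: "(nat monomial \<times> nat monomial) set \<Rightarrow> nat \<Rightarrow> nat" where
  "arc_label E = the_elem ((\<lambda>(m, m'). inv (underlying_perm m) \<circ> underlying_perm m') ` E)"

definition path_perm :: "(nat monomial \<times> nat monomial) set list \<Rightarrow> nat \<Rightarrow> nat" where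
  "path_perm p = foldr (\<circ>) (map arc_label p) id"

section \<open>Well-definedness\<close>

lemma mexp_indets_map: "mexp_indets (map_mexp f t) = map f (mexp_indets t)"
  by (induction t) auto

lemma indets_rename: "indets (rename f m) = map f (indets m)"
  by transfer (rule mexp_indets_map)

lemma rename_rename: "rename f (rename g m) = rename (f \<circ> g) m"
  by transfer (auto simp: mexp.map_comp intro: assoc_eq.refl)

lemma assoc_type_rename: "assoc_type (rename f m) = assoc_type m"
  by (simp add: assoc_type_def rename_rename comp_def)

lemma multilinear_degree: "multilinear n m \<Longrightarrow> degree m = n"
  by (metis card_lessThan degree_def distinct_card multilinear_def)

lemma underlying_perm_permutes:
  assumes "multilinear n m"
  shows "underlying_perm m permutes {..<n}"
proof (rule bij_imp_permutes)
  have "bij_betw ((!) (indets m)) {..<n} {..<n}"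
    using assms multilinear_degree[OF assms]
    by (intro bij_betw_nth) (auto simp: multilinear_def degree_def)
  moreover have "underlying_perm m k = indets m ! k" if "k \<in> {..<n}" for k
    using that by (simp add: underlying_perm_def multilinear_degree[OF assms])
  ultimately show "bij_betw (underlying_perm m) {..<n} {..<n}"
    using bij_betw_cong[of "{..<n}" "underlying_perm m" "(!) (indets m)"] by blast
qed (simp add: underlying_perm_def multilinear_degree[OF assms])

lemma underlying_perm_rename:
  assumes "multilinear n m" and "\<tau> permutes {..<n}"
  shows "underlying_perm (rename \<tau> m) = \<tau> \<circ> underlying_perm m"
  using multilinear_degree[OF assms(1)] permutes_not_in[OF assms(2)]
  by (auto simp: underlying_perm_def degree_def indets_rename)

lemma multilinear_rename:
  assumes "multilinear n m" and "\<tau> permutes {..<n}"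
  shows "multilinear n (rename \<tau> m)"
  using assms permutes_image[OF assms(2)] permutes_inj_on[OF assms(2)]
  by (auto simp: multilinear_def indets_rename distinct_map)

lemma interchange_rename:
  assumes "interchange m m'"
  shows "interchange (rename f m) (rename f m')"
proof -
  have "interchange_mexp (map_mexp f s) (map_mexp f t)" if "interchange_mexp s t" for s t
    using that by induction (auto intro: interchange_mexp.intros)
  with assms show ?thesis
    unfolding interchange_def by (metis rename.abs_eq)
qed

lemma arc_orbit_subset:
  assumes "e \<in> arcs (F n)"
  shows "arc_orbit n e \<subseteq> arcs (F n)"
  using assms by (auto simp: arc_orbit_def F_def intro: multilinear_rename interchange_rename)

lemma arc_orbit_nonempty: "arc_orbit n e \<noteq> {}"
  using permutes_id[of "{..<n}"] unfolding arc_orbit_def by blast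

lemma the_elem_constant:
  assumes "A \<noteq> {}" and "\<And>x. x \<in> A \<Longrightarrow> f x = c"
  shows "the_elem (f ` A) = c"
proof -
  have "f ` A = {c}" using assms by auto
  then show ?thesis by simp
qed

lemma arc_orbit_ends:
  "tail (G n) (arc_orbit n (m, m')) = assoc_type m"
  "head (G n) (arc_orbit n (m, m')) = assoc_type m'"
proof -
  have "the_elem ((\<lambda>(m, m'). assoc_type m) ` arc_orbit n (m, m')) = assoc_type m"
    by (rule the_elem_constant[OF arc_orbit_nonempty])
      (auto simp: arc_orbit_def assoc_type_rename)
  then show "tail (G n) (arc_orbit n (m, m')) = assoc_type m" by (simp add: G_def)
  have "the_elem ((\<lambda>(m, m'). assoc_type m') ` arc_orbit n (m, m')) = assoc_type m'"
    by (rule the_elem_constant[OF arc_orbit_nonempty])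
      (auto simp: arc_orbit_def assoc_type_rename)
  then show "head (G n) (arc_orbit n (m, m')) = assoc_type m'" by (simp add: G_def)
qed

lemma arc_label_orbit:
  assumes "(m, m') \<in> arcs (F n)"
  shows "arc_label (arc_orbit n (m, m')) = inv (underlying_perm m) \<circ> underlying_perm m'"
  unfolding arc_label_def
proof (rule the_elem_constant[OF arc_orbit_nonempty])
  fix e assume "e \<in> arc_orbit n (m, m')"
  then obtain \<tau> where \<tau>: "\<tau> permutes {..<n}" and e: "e = (rename \<tau> m, rename \<tau> m')"
    by (auto simp: arc_orbit_def)
  have m: "multilinear n m" and m': "multilinear n m'"
    using assms by (auto simp: F_def)
  have "inv (\<tau> \<circ> underlying_perm m) \<circ> (\<tau> \<circ> underlying_perm m')
      = inv (underlying_perm m) \<circ> (inv \<tau> \<circ> \<tau>) \<circ> underlying_perm m'"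
    using o_inv_distrib[OF permutes_bij[OF \<tau>] permutes_bij[OF underlying_perm_permutes[OF m]]]
    by (simp add: comp_assoc)
  then show "(case e of (m, m') \<Rightarrow> inv (underlying_perm m) \<circ> underlying_perm m')
      = inv (underlying_perm m) \<circ> underlying_perm m'"
    by (simp add: e underlying_perm_rename[OF m \<tau>] underlying_perm_rename[OF m' \<tau>]
        permutes_inv_o(2)[OF \<tau>])
qed

end

theory Submission imports Defs begin

text \<open>Picture a monomial as a subdivision of a square into rectangles, \<open>\<circ>\<close> stacking vertically and
  \<open>\<bullet>\<close> juxtaposing horizontally. The words read along the four sides are invariant under interchange,
  as concatenation and projection form a double semigroup. So if the association type recurs, every
  indeterminate on the boundary is back in its place, and nothing can happen when at most one
  indeterminate is interior. If one side of the square is a single rectangle, no interchange ever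
  involves that rectangle, and it can be removed. The remaining association types with at least two
  interior rectangles occur only in degrees 7 and 8 and lie in connected components of at most 30
  elements; these are explored exhaustively, up to exchanging the two operations.\<close>

section \<open>Normal forms\<close>

text \<open>Products are kept nested to the right like lists, and this is their append. It is
  associative on the nose, so equality of expressions can replace \<open>\<approx>\<close>.\<close>

fun circ_app :: "'a mexp \<Rightarrow> 'a mexp \<Rightarrow> 'a mexp" where
  "circ_app (x \<^bold>\<circ> y) t = x \<^bold>\<circ> circ_app y t"
| "circ_app (Indet a) t = Indet a \<^bold>\<circ> t"
| "circ_app (x \<^bold>\<bullet> y) t = (x \<^bold>\<bullet> y) \<^bold>\<circ> t"

fun bullet_app :: "'a mexp \<Rightarrow> 'a mexp \<Rightarrow> 'a mexp" where
  "bullet_app (x \<^bold>\<bullet> y) t = x \<^bold>\<bullet> bullet_app y t"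
| "bullet_app (Indet a) t = Indet a \<^bold>\<bullet> t"
| "bullet_app (x \<^bold>\<circ> y) t = (x \<^bold>\<circ> y) \<^bold>\<bullet> t"

primrec nf :: "'a mexp \<Rightarrow> 'a mexp" where
  "nf (Indet a) = Indet a"
| "nf (x \<^bold>\<circ> y) = circ_app (nf x) (nf y)"
| "nf (x \<^bold>\<bullet> y) = bullet_app (nf x) (nf y)"

primrec is_circ :: "'a mexp \<Rightarrow> bool" where
  "is_circ (Indet a) = False"
| "is_circ (x \<^bold>\<circ> y) = True"
| "is_circ (x \<^bold>\<bullet> y) = False"

primrec is_bullet :: "'a mexp \<Rightarrow> bool" where
  "is_bullet (Indet a) = False"
| "is_bullet (x \<^bold>\<circ> y) = False"
| "is_bullet (x \<^bold>\<bullet> y) = True"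

text \<open>Only left factors are restricted: under right nesting the right factor may continue the
  same product.\<close>

primrec normal :: "'a mexp \<Rightarrow> bool" where
  "normal (Indet a) = True"
| "normal (x \<^bold>\<circ> y) = (normal x \<and> normal y \<and> \<not> is_circ x)"
| "normal (x \<^bold>\<bullet> y) = (normal x \<and> normal y \<and> \<not> is_bullet x)"

lemma app_not_circ: "\<not> is_circ x \<Longrightarrow> circ_app x t = x \<^bold>\<circ> t"
  by (cases x) auto

lemma app_not_bullet: "\<not> is_bullet x \<Longrightarrow> bullet_app x t = x \<^bold>\<bullet> t"
  by (cases x) auto

lemma circ_app_assoc: "circ_app (circ_app x y) z = circ_app x (circ_app y z)"
  by (induction x) auto

lemma bullet_app_assoc: "bullet_app (bullet_app x y) z = bullet_app x (bullet_app y z)"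
  by (induction x) auto

lemma is_circ_circ_app [simp]: "is_circ (circ_app x y)" "\<not> is_bullet (circ_app x y)"
  by (cases x; simp)+

lemma is_bullet_bullet_app [simp]: "is_bullet (bullet_app x y)" "\<not> is_circ (bullet_app x y)"
  by (cases x; simp)+

lemma normal_circ_app: "normal x \<Longrightarrow> normal y \<Longrightarrow> normal (circ_app x y)"
  by (induction x) auto

lemma normal_bullet_app: "normal x \<Longrightarrow> normal y \<Longrightarrow> normal (bullet_app x y)"
  by (induction x) auto

lemma normal_nf: "normal (nf s)"
  by (induction s) (auto intro: normal_circ_app normal_bullet_app)

lemma nf_assoc_eq: "s \<approx> t \<Longrightarrow> nf s = nf t"
  by (induction rule: assoc_eq.induct) (auto simp: circ_app_assoc bullet_app_assoc)

context notes [trans] = assoc_eq.trans begin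

lemma circ_app_assoc_eq: "x \<^bold>\<circ> y \<approx> circ_app x y"
proof (induction x)
  case (Circ x1 x2)
  have "(x1 \<^bold>\<circ> x2) \<^bold>\<circ> y \<approx> x1 \<^bold>\<circ> (x2 \<^bold>\<circ> y)" by (rule assoc_eq.assoc_Circ)
  also have "x1 \<^bold>\<circ> (x2 \<^bold>\<circ> y) \<approx> x1 \<^bold>\<circ> circ_app x2 y"
    by (rule assoc_eq.cong_Circ[OF assoc_eq.refl Circ(2)])
  finally show ?case by simp
qed (auto intro: assoc_eq.refl)

lemma bullet_app_assoc_eq: "x \<^bold>\<bullet> y \<approx> bullet_app x y"
proof (induction x)
  case (Bullet x1 x2)
  have "(x1 \<^bold>\<bullet> x2) \<^bold>\<bullet> y \<approx> x1 \<^bold>\<bullet> (x2 \<^bold>\<bullet> y)" by (rule assoc_eq.assoc_Bullet)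
  also have "x1 \<^bold>\<bullet> (x2 \<^bold>\<bullet> y) \<approx> x1 \<^bold>\<bullet> bullet_app x2 y"
    by (rule assoc_eq.cong_Bullet[OF assoc_eq.refl Bullet(2)])
  finally show ?case by simp
qed (auto intro: assoc_eq.refl)

end

lemma assoc_eq_nf: "s \<approx> nf s"
proof (induction s)
  case (Circ x y)
  show ?case
    using assoc_eq.trans[OF assoc_eq.cong_Circ[OF Circ] circ_app_assoc_eq] by simp
next
  case (Bullet x y)
  show ?case
    using assoc_eq.trans[OF assoc_eq.cong_Bullet[OF Bullet] bullet_app_assoc_eq] by simp
qed (simp add: assoc_eq.refl)

lemma map_circ_app: "map_mexp f (circ_app x y) = circ_app (map_mexp f x) (map_mexp f y)"
  by (induction x) auto

lemma map_bullet_app: "map_mexp f (bullet_app x y) = bullet_app (map_mexp f x) (map_mexp f y)"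
  by (induction x) auto

lemma nf_map: "nf (map_mexp f s) = map_mexp f (nf s)"
  by (induction s) (auto simp: map_circ_app map_bullet_app)

lemma mexp_indets_circ_app [simp]: "mexp_indets (circ_app x y) = mexp_indets x @ mexp_indets y"
  by (induction x) auto

lemma mexp_indets_bullet_app [simp]: "mexp_indets (bullet_app x y) = mexp_indets x @ mexp_indets y"
  by (induction x) auto

lemma mexp_indets_nf: "mexp_indets (nf s) = mexp_indets s"
  by (induction s) auto

lemma mexp_indets_not_Nil [simp]: "mexp_indets s \<noteq> []"
  by (induction s) auto

lemma set_mexp_indets: "set_mexp s = set (mexp_indets s)"
  by (induction s) auto

text \<open>With \<open>abs_normal_form\<close>, this selects one computable representative of each
  class, so the argument can be carried out on expressions.\<close>

lift_definition normal_form :: "'a monomial \<Rightarrow> 'a mexp" is nf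
  by (rule nf_assoc_eq)

lemma abs_normal_form: "abs_monomial (normal_form m) = m"
proof transfer
  fix s :: "'a mexp"
  show "nf s \<approx> s" by (rule assoc_eq.sym[OF assoc_eq_nf])
qed

lemma normal_normal_form: "normal (normal_form m)"
  by transfer (rule normal_nf)

lemma indets_normal_form: "mexp_indets (normal_form m) = indets m"
  by transfer (rule mexp_indets_nf)

lemma normal_form_rename: "normal_form (rename f m) = map_mexp f (normal_form m)"
  by transfer (rule nf_map)

section \<open>Interchange on normal forms\<close>

primrec circ_splits :: "'a mexp \<Rightarrow> ('a mexp \<times> 'a mexp) list" where
  "circ_splits (Indet a) = []"
| "circ_splits (x \<^bold>\<circ> y) = (x, y) # map (\<lambda>(u, v). (x \<^bold>\<circ> u, v)) (circ_splits y)"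
| "circ_splits (x \<^bold>\<bullet> y) = []"

primrec bullet_splits :: "'a mexp \<Rightarrow> ('a mexp \<times> 'a mexp) list" where
  "bullet_splits (Indet a) = []"
| "bullet_splits (x \<^bold>\<circ> y) = []"
| "bullet_splits (x \<^bold>\<bullet> y) = (x, y) # map (\<lambda>(u, v). (x \<^bold>\<bullet> u, v)) (bullet_splits y)"

text \<open>The cuts of \<open>s\<close> and \<open>t\<close> are chosen independently: the
  interchange relation does not ask them to be aligned.\<close>

definition circ_moves :: "'a mexp \<Rightarrow> 'a mexp \<Rightarrow> 'a mexp list" where
  "circ_moves s t = concat (map (\<lambda>(w, x). map (\<lambda>(y, z).
     bullet_app (circ_app w y) (circ_app x z)) (bullet_splits t)) (bullet_splits s))"

definition bullet_moves :: "'a mexp \<Rightarrow> 'a mexp \<Rightarrow> 'a mexp list" where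
  "bullet_moves s t = concat (map (\<lambda>(w, x). map (\<lambda>(y, z).
     circ_app (bullet_app w y) (bullet_app x z)) (circ_splits t)) (circ_splits s))"

text \<open>Only two adjacent factors of a maximal product can interact: a longer block of factors of a
  \<open>\<circ>\<close>-product is itself a \<open>\<circ>\<close>-product and has no factorization with respect to \<open>\<bullet>\<close>.\<close>

primrec nbrs :: "'a mexp \<Rightarrow> 'a mexp list" where
  "nbrs (Indet a) = []"
| "nbrs (s \<^bold>\<circ> t) = map (\<lambda>s'. circ_app s' t) (nbrs s) @ map (circ_app s) (nbrs t) @
     (case t of Indet a \<Rightarrow> [] | u \<^bold>\<circ> v \<Rightarrow> map (\<lambda>x. circ_app x v) (circ_moves s u)
      | u \<^bold>\<bullet> v \<Rightarrow> circ_moves s t)"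
| "nbrs (s \<^bold>\<bullet> t) = map (\<lambda>s'. bullet_app s' t) (nbrs s) @ map (bullet_app s) (nbrs t) @
     (case t of Indet a \<Rightarrow> [] | u \<^bold>\<circ> v \<Rightarrow> bullet_moves s t
      | u \<^bold>\<bullet> v \<Rightarrow> map (\<lambda>x. bullet_app x v) (bullet_moves s u))"

section \<open>Completeness of the computed neighbours\<close>

lemma circ_splits_app: "normal w \<Longrightarrow> (w, x) \<in> set (circ_splits (circ_app w x))"
  by (induction w) auto

lemma bullet_splits_app: "normal w \<Longrightarrow> (w, x) \<in> set (bullet_splits (bullet_app w x))"
  by (induction w) auto

lemma bullet_splitsD:
  assumes "normal t" "(w, x) \<in> set (bullet_splits t)"
  shows "t = bullet_app w x \<and> normal w \<and> normal x"
  using assms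
proof (induction t arbitrary: w)
  case (Bullet a b)
  from Bullet.prems(2) consider "w = a" "x = b"
    | u where "w = a \<^bold>\<bullet> u" "(u, x) \<in> set (bullet_splits b)"
    by auto
  then show ?case
  proof cases
    case 1
    with Bullet.prems(1) show ?thesis by (simp add: app_not_bullet)
  next
    case 2
    from Bullet.prems(1) have "normal b" by simp
    from Bullet.IH(2)[OF this 2(2)] Bullet.prems(1) 2(1) show ?thesis by simp
  qed
next
  case (Circ a b)
  from Circ.prems show ?case by simp
qed simp

lemma bullet_splits_not_bullet: "\<not> is_bullet s \<Longrightarrow> bullet_splits s = []"
  by (cases s) auto

lemma circ_splits_not_circ: "\<not> is_circ s \<Longrightarrow> circ_splits s = []"
  by (cases s) auto

lemma circ_moves_eq_Nil: "\<not> is_bullet s \<or> \<not> is_bullet t \<Longrightarrow> circ_moves s t = []"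
  by (auto simp: circ_moves_def bullet_splits_not_bullet)

lemma bullet_moves_eq_Nil: "\<not> is_circ s \<or> \<not> is_circ t \<Longrightarrow> bullet_moves s t = []"
  by (auto simp: bullet_moves_def circ_splits_not_circ)

text \<open>Merging \<open>u\<close> into a longer product must not lose moves. When the last two
  factors of \<open>u\<close> interact, \<open>t\<close> now follows them, so the move passes from
  the clause of \<open>nbrs\<close> for exactly two factors to the clause for a prefix.\<close>

lemma nbrs_circ_left:
  assumes "u' \<in> set (nbrs u)" "normal u"
  shows "circ_app u' t \<in> set (nbrs (circ_app u t))"
  using assms
proof (induction u arbitrary: u')
  case (Circ c r)
  consider (c) c' where "c' \<in> set (nbrs c)" "u' = circ_app c' r"
    | (r) r' where "r' \<in> set (nbrs r)" "u' = circ_app c r'"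
    | (b) "\<not> is_circ r" "u' \<in> set (circ_moves c r)"
    | (m) r1 r2 x where "r = r1 \<^bold>\<circ> r2" "x \<in> set (circ_moves c r1)" "u' = circ_app x r2"
    using Circ.prems(1) by (cases r) fastforce+
  then show ?case
  proof cases
    case c then show ?thesis by (auto simp: circ_app_assoc)
  next
    case r
    with Circ.IH(2)[of r'] Circ.prems(2) have "circ_app r' t \<in> set (nbrs (circ_app r t))"
      by simp
    with r show ?thesis by (simp add: circ_app_assoc)
  next
    case b
    then have "is_bullet r" using circ_moves_eq_Nil[of c r] by (cases "is_bullet r") auto
    with b show ?thesis by (cases r) auto
  next
    case m then show ?thesis by (auto simp: circ_app_assoc)
  qed
qed auto

lemma nbrs_bullet_left:
  assumes "u' \<in> set (nbrs u)" "normal u"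
  shows "bullet_app u' t \<in> set (nbrs (bullet_app u t))"
  using assms
proof (induction u arbitrary: u')
  case (Bullet c r)
  consider (c) c' where "c' \<in> set (nbrs c)" "u' = bullet_app c' r"
    | (r) r' where "r' \<in> set (nbrs r)" "u' = bullet_app c r'"
    | (b) "\<not> is_bullet r" "u' \<in> set (bullet_moves c r)"
    | (m) r1 r2 x where "r = r1 \<^bold>\<bullet> r2" "x \<in> set (bullet_moves c r1)" "u' = bullet_app x r2"
    using Bullet.prems(1) by (cases r) fastforce+
  then show ?case
  proof cases
    case c then show ?thesis by (auto simp: bullet_app_assoc)
  next
    case r
    with Bullet.IH(2)[of r'] Bullet.prems(2) have "bullet_app r' t \<in> set (nbrs (bullet_app r t))"
      by simp
    with r show ?thesis by (simp add: bullet_app_assoc)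
  next
    case b
    then have "is_circ r" using bullet_moves_eq_Nil[of c r] by (cases "is_circ r") auto
    with b show ?thesis by (cases r) auto
  next
    case m then show ?thesis by (auto simp: bullet_app_assoc)
  qed
qed auto

lemma nbrs_circ_right:
  assumes "t' \<in> set (nbrs t)" "normal u"
  shows "circ_app u t' \<in> set (nbrs (circ_app u t))"
  using assms
proof (induction u)
  case (Circ c r)
  then show ?case by (auto simp: app_not_circ)
qed auto

lemma nbrs_bullet_right:
  assumes "t' \<in> set (nbrs t)" "normal u"
  shows "bullet_app u t' \<in> set (nbrs (bullet_app u t))"
  using assms
proof (induction u)
  case (Bullet c r)
  then show ?case by (auto simp: app_not_bullet)
qed auto

lemma circ_moves_iff:
  "r \<in> set (circ_moves s t) \<longleftrightarrow> (\<exists>w x y z. (w, x) \<in> set (bullet_splits s) \<and>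
    (y, z) \<in> set (bullet_splits t) \<and> r = bullet_app (circ_app w y) (circ_app x z))"
  unfolding circ_moves_def by fastforce

lemma bullet_moves_iff:
  "r \<in> set (bullet_moves s t) \<longleftrightarrow> (\<exists>w y x z. (w, y) \<in> set (circ_splits s) \<and>
    (x, z) \<in> set (circ_splits t) \<and> r = circ_app (bullet_app w x) (bullet_app y z))"
  unfolding bullet_moves_def by fastforce

lemma nbrs_forward:
  assumes "normal w" "normal y"
  shows "bullet_app (circ_app w y) (circ_app x z)
    \<in> set (nbrs (circ_app (bullet_app w x) (bullet_app y z)))"
proof -
  have "bullet_app (circ_app w y) (circ_app x z)
      \<in> set (circ_moves (bullet_app w x) (bullet_app y z))"
    unfolding circ_moves_iff using assms bullet_splits_app by blast
  moreover obtain a b where "bullet_app y z = a \<^bold>\<bullet> b"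
    by (cases "bullet_app y z") (metis is_bullet.simps is_bullet_bullet_app(1))+
  ultimately show ?thesis by (simp add: app_not_circ)
qed

lemma nbrs_backward:
  assumes "normal w" "normal x"
  shows "circ_app (bullet_app w x) (bullet_app y z)
    \<in> set (nbrs (bullet_app (circ_app w y) (circ_app x z)))"
proof -
  have "circ_app (bullet_app w x) (bullet_app y z)
      \<in> set (bullet_moves (circ_app w y) (circ_app x z))"
    unfolding bullet_moves_iff using assms circ_splits_app by blast
  moreover obtain a b where "circ_app x z = a \<^bold>\<circ> b"
    by (cases "circ_app x z") (metis is_circ.simps is_circ_circ_app(1))+
  ultimately show ?thesis by (simp add: app_not_bullet)
qed

text \<open>Each bracketing that exposes an interchange is covered. It is this inclusion that
  matters: whatever interchange can reach, \<open>step\<close> reaches too, so rigidity under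
  \<open>step\<close> suffices.\<close>

lemma nbrs_interchange:
  assumes "interchange_mexp s t"
  shows "nf t \<in> set (nbrs (nf s))"
  using assms
  by induction (auto intro: nbrs_forward nbrs_backward nbrs_circ_left nbrs_circ_right
      nbrs_bullet_left nbrs_bullet_right normal_nf)

abbreviation step :: "'a mexp \<Rightarrow> 'a mexp \<Rightarrow> bool" where
  "step s t \<equiv> t \<in> set (nbrs s)"

lemma step_normal_form:
  assumes "interchange m m'"
  shows "step (normal_form m) (normal_form m')"
  using assms unfolding interchange_def
  by (auto simp: normal_form.abs_eq intro: nbrs_interchange)

text \<open>The splits are turned back into appends, through which homomorphisms can be evaluated.
  \<open>all\<close> and \<open>prefix\<close> differ in whether factors remain after the two that
  interact.\<close>

lemma step_circE:
  assumes "step (s \<^bold>\<circ> t) v" "normal (s \<^bold>\<circ> t)"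
  obtains (left) s' where "step s s'" "v = circ_app s' t"
  | (right) t' where "step t t'" "v = circ_app s t'"
  | (all) w x y z where "s = bullet_app w x" "t = bullet_app y z"
      "v = bullet_app (circ_app w y) (circ_app x z)"
      "normal w" "normal x" "normal y" "normal z"
  | (prefix) w x y z r where "s = bullet_app w x" "t = bullet_app y z \<^bold>\<circ> r"
      "v = circ_app (bullet_app (circ_app w y) (circ_app x z)) r"
      "normal w" "normal x" "normal y" "normal z"
proof -
  from assms(1) consider "\<exists>s'. step s s' \<and> v = circ_app s' t" | "\<exists>t'. step t t' \<and> v = circ_app s t'"
    | "v \<in> set (circ_moves s t)" | p r q where "t = p \<^bold>\<circ> r" "q \<in> set (circ_moves s p)" "v = circ_app q r"
    by (cases t) fastforce+
  then show thesis
  proof cases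
    case 3
    with assms(2) show thesis
      unfolding circ_moves_iff by (metis all bullet_splitsD normal.simps(2))
  next
    case 4
    with assms(2) show thesis
      unfolding circ_moves_iff by (metis prefix bullet_splitsD normal.simps(2))
  qed (use left right in blast)+
qed

section \<open>Duality and boundary words\<close>

text \<open>Reflection of the square in the diagonal through its top left corner. The interchange
  relation is self-dual, so statements about \<circ>, top and bottom pass to \<bullet>, left and
  right.\<close>

primrec dual :: "'a mexp \<Rightarrow> 'a mexp" where
  "dual (Indet a) = Indet a"
| "dual (x \<^bold>\<circ> y) = dual x \<^bold>\<bullet> dual y"
| "dual (x \<^bold>\<bullet> y) = dual x \<^bold>\<circ> dual y"

lemma dual_dual [simp]: "dual (dual s) = s"
  by (induction s) auto

lemma dual_circ_app: "dual (circ_app x y) = bullet_app (dual x) (dual y)"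
  by (induction x) auto

lemma dual_bullet_app: "dual (bullet_app x y) = circ_app (dual x) (dual y)"
  by (induction x) auto

lemma is_circ_dual [simp]: "is_circ (dual s) = is_bullet s"
  by (cases s) auto

lemma is_bullet_dual [simp]: "is_bullet (dual s) = is_circ s"
  by (cases s) auto

lemma normal_dual [simp]: "normal (dual s) = normal s"
  by (induction s) auto

lemma mexp_indets_dual [simp]: "mexp_indets (dual s) = mexp_indets s"
  by (induction s) auto

lemma map_dual: "map_mexp f (dual s) = dual (map_mexp f s)"
  by (induction s) auto

lemma dual_eq_iff [simp]: "dual s = dual t \<longleftrightarrow> s = t"
  by (metis dual_dual)

lemma circ_splits_dual:
  "circ_splits (dual s) = map (map_prod dual dual) (bullet_splits s)"
  "bullet_splits (dual s) = map (map_prod dual dual) (circ_splits s)"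
  by (induction s) (auto simp: map_prod_def split_def)

lemma circ_moves_dual:
  "circ_moves (dual s) (dual t) = map dual (bullet_moves s t)"
  "bullet_moves (dual s) (dual t) = map dual (circ_moves s t)"
  by (simp_all add: circ_moves_def bullet_moves_def circ_splits_dual map_concat comp_def split_def
      dual_circ_app dual_bullet_app)

lemma nbrs_dual: "nbrs (dual s) = map dual (nbrs s)"
proof (induction s)
  case (Circ s t)
  have "(case dual t of Indet a \<Rightarrow> [] | u \<^bold>\<circ> v \<Rightarrow> bullet_moves (dual s) (dual t)
      | u \<^bold>\<bullet> v \<Rightarrow> map (\<lambda>x. bullet_app x v) (bullet_moves (dual s) u)) =
    map dual (case t of Indet a \<Rightarrow> [] | u \<^bold>\<circ> v \<Rightarrow> map (\<lambda>x. circ_app x v) (circ_moves s u)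
      | u \<^bold>\<bullet> v \<Rightarrow> circ_moves s t)"
    using circ_moves_dual(2)[of s t]
    by (cases t) (simp_all add: circ_moves_dual dual_circ_app comp_def)
  with Circ show ?case by (simp add: comp_def dual_circ_app)
next
  case (Bullet s t)
  have "(case dual t of Indet a \<Rightarrow> [] | u \<^bold>\<circ> v \<Rightarrow> map (\<lambda>x. circ_app x v) (circ_moves (dual s) u)
      | u \<^bold>\<bullet> v \<Rightarrow> circ_moves (dual s) (dual t)) =
    map dual (case t of Indet a \<Rightarrow> [] | u \<^bold>\<circ> v \<Rightarrow> bullet_moves s t
      | u \<^bold>\<bullet> v \<Rightarrow> map (\<lambda>x. bullet_app x v) (bullet_moves s u))"
    using circ_moves_dual(1)[of s t]
    by (cases t) (simp_all add: circ_moves_dual dual_bullet_app comp_def)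
  with Bullet show ?case by (simp add: comp_def dual_bullet_app)
qed simp

lemma step_dual: "step s t \<Longrightarrow> step (dual s) (dual t)"
  by (simp add: nbrs_dual)

lemma steps_dual: "step\<^sup>*\<^sup>* s t \<Longrightarrow> step\<^sup>*\<^sup>* (dual s) (dual t)"
  by (induction rule: rtranclp_induct) (blast intro: rtranclp.rtrancl_into_rtrancl step_dual)+

section \<open>Words along the four sides of the square\<close>

primrec top_word :: "'a mexp \<Rightarrow> 'a list" where
  "top_word (Indet a) = [a]"
| "top_word (s \<^bold>\<circ> t) = top_word s"
| "top_word (s \<^bold>\<bullet> t) = top_word s @ top_word t"

primrec bottom_word :: "'a mexp \<Rightarrow> 'a list" where
  "bottom_word (Indet a) = [a]"
| "bottom_word (s \<^bold>\<circ> t) = bottom_word t"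
| "bottom_word (s \<^bold>\<bullet> t) = bottom_word s @ bottom_word t"

definition left_word :: "'a mexp \<Rightarrow> 'a list" where
  "left_word s = top_word (dual s)"

definition right_word :: "'a mexp \<Rightarrow> 'a list" where
  "right_word s = bottom_word (dual s)"

lemma left_word_simps [simp]:
  "left_word (Indet a) = [a]"
  "left_word (s \<^bold>\<circ> t) = left_word s @ left_word t"
  "left_word (s \<^bold>\<bullet> t) = left_word s"
  by (auto simp: left_word_def)

lemma right_word_simps [simp]:
  "right_word (Indet a) = [a]"
  "right_word (s \<^bold>\<circ> t) = right_word s @ right_word t"
  "right_word (s \<^bold>\<bullet> t) = right_word t"
  by (auto simp: right_word_def)

lemma top_word_app [simp]:
  "top_word (circ_app s t) = top_word s"
  "top_word (bullet_app s t) = top_word s @ top_word t"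
  by (induction s) auto

lemma bottom_word_app [simp]:
  "bottom_word (circ_app s t) = bottom_word t"
  "bottom_word (bullet_app s t) = bottom_word s @ bottom_word t"
  by (induction s) auto

lemma word_map:
  "top_word (map_mexp f s) = map f (top_word s)"
  "bottom_word (map_mexp f s) = map f (bottom_word s)"
  by (induction s) auto

lemma word_not_Nil [simp]: "top_word s \<noteq> []" "bottom_word s \<noteq> []"
  by (induction s) auto

lemma step_bulletE:
  assumes "step (s \<^bold>\<bullet> t) v" "normal (s \<^bold>\<bullet> t)"
  obtains (left) s' where "step s s'" "v = bullet_app s' t"
  | (right) t' where "step t t'" "v = bullet_app s t'"
  | (all) w x y z where "s = circ_app w x" "t = circ_app y z"
      "v = circ_app (bullet_app w y) (bullet_app x z)"
      "normal w" "normal x" "normal y" "normal z"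
  | (prefix) w x y z r where "s = circ_app w x" "t = circ_app y z \<^bold>\<bullet> r"
      "v = bullet_app (circ_app (bullet_app w y) (bullet_app x z)) r"
      "normal w" "normal x" "normal y" "normal z"
proof -
  note left' = left and right' = right and all' = all and prefix' = prefix
  have "step (dual s \<^bold>\<circ> dual t) (dual v)" "normal (dual s \<^bold>\<circ> dual t)"
    using step_dual[OF assms(1)] assms(2) by auto
  then show thesis
  proof (cases rule: step_circE)
    case (left s')
    show thesis
      by (rule left'[of "dual s'"])
        (use left step_dual[OF left(1)] in \<open>simp_all flip: dual_eq_iff[of v] add: dual_bullet_app\<close>)
  next
    case (right t')
    show thesis
      by (rule right'[of "dual t'"])
        (use right step_dual[OF right(1)] in \<open>simp_all flip: dual_eq_iff[of v] add: dual_bullet_app\<close>)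
  next
    case (all w x y z)
    show thesis
      by (rule all'[of "dual w" "dual x" "dual y" "dual z"])
        (use all in \<open>simp_all flip: dual_eq_iff[of v] dual_eq_iff[of s] dual_eq_iff[of t]
          add: dual_bullet_app dual_circ_app\<close>)
  next
    case (prefix w x y z r)
    show thesis
      by (rule prefix'[of "dual w" "dual x" "dual y" "dual z" "dual r"])
        (use prefix in \<open>simp_all flip: dual_eq_iff[of v] dual_eq_iff[of s] dual_eq_iff[of t]
          add: dual_bullet_app dual_circ_app\<close>)
  qed
qed

text \<open>\<open>I\<close> is a homomorphism to a structure with operations \<open>c\<close> and
  \<open>b\<close> that obey interchange by \<open>ic\<close>; associativity on its values is
  inherited from the two appends. Both ends of a move then have the same value. Normality is proved
  alongside so that the statement can be iterated.\<close>

lemma step_invariant: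
  assumes c: "\<And>x y. I (circ_app x y) = c (I x) (I y)"
    and b: "\<And>x y. I (bullet_app x y) = b (I x) (I y)"
    and ic: "\<And>w x y z. c (b w x) (b y z) = b (c w y) (c x z)"
    and "step s t" "normal s"
  shows "normal t \<and> I t = I s"
  using assms(4,5)
proof (induction s arbitrary: t)
  case (Circ s1 s2)
  have s: "s1 \<^bold>\<circ> s2 = circ_app s1 s2" using Circ.prems by (simp add: app_not_circ)
  have n: "normal s1" "normal s2" using Circ.prems by auto
  from Circ.prems show ?case
  proof (cases rule: step_circE)
    case (left s')
    with Circ.IH(1)[OF left(1)] n show ?thesis by (simp add: s c normal_circ_app)
  next
    case (right t')
    with Circ.IH(2)[OF right(1)] n show ?thesis by (simp add: s c normal_circ_app)
  next
    case (all w x y z)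
    have "s1 \<^bold>\<circ> s2 = circ_app (bullet_app w x) (bullet_app y z)"
      by (subst s) (simp only: all(1,2))
    with all show ?thesis by (simp add: c b ic normal_circ_app normal_bullet_app)
  next
    case (prefix w x y z r)
    have "s1 \<^bold>\<circ> s2 = circ_app (circ_app (bullet_app w x) (bullet_app y z)) r"
      by (simp add: s prefix(1,2) app_not_circ circ_app_assoc)
    with prefix n show ?thesis by (simp add: c b ic normal_circ_app normal_bullet_app)
  qed
next
  case (Bullet s1 s2)
  have s: "s1 \<^bold>\<bullet> s2 = bullet_app s1 s2" using Bullet.prems by (simp add: app_not_bullet)
  have n: "normal s1" "normal s2" using Bullet.prems by auto
  from Bullet.prems show ?case
  proof (cases rule: step_bulletE)
    case (left s')
    with Bullet.IH(1)[OF left(1)] n show ?thesis by (simp add: s b normal_bullet_app)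
  next
    case (right t')
    with Bullet.IH(2)[OF right(1)] n show ?thesis by (simp add: s b normal_bullet_app)
  next
    case (all w x y z)
    have "s1 \<^bold>\<bullet> s2 = bullet_app (circ_app w x) (circ_app y z)"
      by (subst s) (simp only: all(1,2))
    with all show ?thesis by (simp add: c b ic normal_circ_app normal_bullet_app)
  next
    case (prefix w x y z r)
    have "s1 \<^bold>\<bullet> s2 = bullet_app (bullet_app (circ_app w x) (circ_app y z)) r"
      by (simp add: s prefix(1,2) app_not_bullet bullet_app_assoc)
    with prefix n show ?thesis by (simp add: c b ic normal_circ_app normal_bullet_app)
  qed
qed simp

text \<open>For the one-point double semigroup the invariant is trivial and only normality is
  left.\<close>

lemma step_normal: "step s t \<Longrightarrow> normal s \<Longrightarrow> normal t"
  using step_invariant[of "\<lambda>_. ()" "\<lambda>_ _. ()" "\<lambda>_ _. ()"] by blast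

text \<open>For the top word \<circ> acts as left projection, since the upper factor hides the
  lower, and for the bottom word as right projection; left and right words exchange the roles of the
  operations. For the multiset both operations are addition, where interchange follows from
  commutativity.\<close>

lemma step_words:
  assumes "step s t" "normal s"
  shows "top_word t = top_word s" "bottom_word t = bottom_word s" "left_word t = left_word s"
    "right_word t = right_word s" "mset (mexp_indets t) = mset (mexp_indets s)"
proof -
  show "top_word t = top_word s"
    using step_invariant[of top_word "\<lambda>x y. x" "(@)"] assms by force
  show "bottom_word t = bottom_word s"
    using step_invariant[of bottom_word "\<lambda>x y. y" "(@)"] assms by force
  show "left_word t = left_word s"
    using step_invariant[of left_word "(@)" "\<lambda>x y. x"] assms
    by (force simp: left_word_def dual_circ_app dual_bullet_app)
  show "right_word t = right_word s"
    using step_invariant[of right_word "(@)" "\<lambda>x y. y"] assms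
    by (force simp: right_word_def dual_circ_app dual_bullet_app)
  show "mset (mexp_indets t) = mset (mexp_indets s)"
    using step_invariant[of "\<lambda>s. mset (mexp_indets s)" "(+)" "(+)"] assms by force
qed

lemma steps_words:
  assumes "step\<^sup>*\<^sup>* s t" "normal s"
  shows "normal t \<and> top_word t = top_word s \<and> bottom_word t = bottom_word s \<and>
    left_word t = left_word s \<and> right_word t = right_word s \<and>
    mset (mexp_indets t) = mset (mexp_indets s)"
  using assms(1)
  by (induction rule: rtranclp_induct) (use assms(2) step_normal step_words in \<open>simp | metis\<close>)+

section \<open>Removing a rectangle that fills a whole side\<close>

lemma steps_peel_first:
  assumes "step\<^sup>*\<^sup>* (Indet a \<^bold>\<circ> s) t"
  shows "\<exists>t'. t = Indet a \<^bold>\<circ> t' \<and> step\<^sup>*\<^sup>* s t'"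
  using assms
proof (induction rule: rtranclp_induct)
  case (step u v)
  then obtain u' where u': "u = Indet a \<^bold>\<circ> u'" "step\<^sup>*\<^sup>* s u'" by blast
  \<comment> \<open>An indeterminate has no factorization, so the first factor takes part in no
    move.\<close>
  have "circ_moves (Indet a) q = []" for q by (simp add: circ_moves_eq_Nil)
  with step(2) u'(1) obtain v' where "v = Indet a \<^bold>\<circ> v'" "step u' v'"
    by (cases u') auto
  with u' show ?case by (metis rtranclp.rtrancl_into_rtrancl)
qed blast

text \<open>The last factor sits at the deep end of the right-nested product, hence the induction on
  \<open>s\<close>. Having no factorization, it can interact with nothing.\<close>

lemma step_peel_last:
  assumes "step (circ_app s (Indet a)) t" "normal s"
  shows "\<exists>t'. t = circ_app t' (Indet a) \<and> step s t'"
  using assms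
proof (induction s arbitrary: t)
  case (Circ c r)
  have c: "circ_app c x = c \<^bold>\<circ> x" for x using Circ.prems(2) by (simp add: app_not_circ)
  have "step (c \<^bold>\<circ> circ_app r (Indet a)) t" "normal (c \<^bold>\<circ> circ_app r (Indet a))"
    using Circ.prems by (simp_all add: normal_circ_app)
  then show ?case
  proof (cases rule: step_circE)
    case (left s')
    then show ?thesis by (auto intro!: exI[of _ "circ_app s' r"] simp: circ_app_assoc)
  next
    case (right t')
    with Circ obtain r' where "t' = circ_app r' (Indet a)" "step r r'" by auto
    with right show ?thesis
      by (auto intro!: exI[of _ "circ_app c r'"] simp: circ_app_assoc)
  next
    \<comment> \<open>Impossible: \<open>circ_app r (Indet a)\<close> is a \<circ>-product and
      \<open>bullet_app y z\<close> a \<bullet>-product.\<close>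
    case (all w x y z)
    then show ?thesis by (metis is_circ_circ_app(1) is_bullet_bullet_app(2))
  next
    case (prefix w x y z q)
    let ?m = "bullet_app (circ_app w y) (circ_app x z)"
    have m: "?m \<in> set (circ_moves c (bullet_app y z))"
      using prefix unfolding circ_moves_iff by (metis bullet_splits_app)
    \<comment> \<open>If \<open>s\<close> has just the two factors that interact, the remainder
      \<open>q\<close> is the indeterminate alone; otherwise \<open>q\<close> still begins with
      further factors of \<open>s\<close>.\<close>
    show ?thesis
    proof (cases "is_circ r")
      case True
      then obtain r1 r2 where r: "r = r1 \<^bold>\<circ> r2" by (cases r) auto
      with prefix(2) have "r1 = bullet_app y z" "q = circ_app r2 (Indet a)" by auto
      with m r prefix(3) show ?thesis
        by (auto intro!: exI[of _ "circ_app ?m r2"] simp: circ_app_assoc)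
    next
      case False
      with prefix(2) have "r = bullet_app y z" "q = Indet a" by (auto simp: app_not_circ)
      moreover from this obtain b d where r: "r = b \<^bold>\<bullet> d"
        by (cases r) (metis is_bullet.simps is_bullet_bullet_app(1))+
      ultimately have "?m \<in> set (circ_moves c r)" "t = circ_app ?m (Indet a)"
        using m prefix(3) by simp_all
      then show ?thesis by (auto simp: r)
    qed
  qed
next
  case (Indet b)
  then show ?case by simp
next
  case (Bullet b d)
  then show ?case by (auto simp: circ_moves_eq_Nil)
qed

lemma steps_peel_last:
  assumes "step\<^sup>*\<^sup>* (circ_app s (Indet a)) t" "normal s"
  shows "\<exists>t'. t = circ_app t' (Indet a) \<and> step\<^sup>*\<^sup>* s t'"
  using assms(1)
proof (induction rule: rtranclp_induct)
  case (step u v)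
  then obtain u' where u': "u = circ_app u' (Indet a)" "step\<^sup>*\<^sup>* s u'" by blast
  with assms(2) have "normal u'" by (simp add: steps_words)
  with step_peel_last u' step(2) show ?case by (metis rtranclp.rtrancl_into_rtrancl)
qed blast

text \<open>Normality makes the first factor of a \<circ>-product an indeterminate or a
  \<bullet>-product, and the latter has a top word of at least two letters.\<close>

lemma top_word_single:
  assumes "normal s" "length (top_word s) = 1"
  shows "(\<exists>a. s = Indet a) \<or> (\<exists>a t. s = Indet a \<^bold>\<circ> t)"
proof (cases s)
  case (Circ u v)
  with assms show ?thesis by (cases u) (auto simp: Suc_eq_plus1[symmetric] add_is_1)
qed (use assms in \<open>auto simp: add_is_1\<close>)

lemma bottom_word_single:
  assumes "normal s" "length (bottom_word s) = 1"
  shows "(\<exists>a. s = Indet a) \<or> (\<exists>a t. normal t \<and> s = circ_app t (Indet a))"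
  using assms
proof (induction s)
  case (Circ u v)
  then consider a where "v = Indet a" | a t where "normal t" "v = circ_app t (Indet a)" by auto
  then show ?case
  proof cases
    case 1
    with Circ.prems show ?thesis by (metis app_not_circ normal.simps(2))
  next
    case 2
    with Circ.prems have "normal (u \<^bold>\<circ> t)" "u \<^bold>\<circ> v = circ_app (u \<^bold>\<circ> t) (Indet a)" by auto
    then show ?thesis by blast
  qed
qed (auto simp: add_is_1)

lemma circ_app_neq_Indet [simp]: "circ_app x y \<noteq> Indet a" "Indet a \<noteq> circ_app x y"
  by (cases x; simp)+

text \<open>The last factor can be read off at the end of the right spine. This is applied to
  shapes, to pass from equal shapes of two products to equal shapes of what remains after
  peeling.\<close>

lemma circ_app_Indet_cancel:
  "circ_app x (Indet a) = circ_app y (Indet b) \<longleftrightarrow> x = y \<and> a = b"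
proof (induction x arbitrary: y)
  case (Circ x1 x2)
  then show ?case by (cases y) auto
next
  case (Indet c)
  then show ?case by (cases y) auto
next
  case (Bullet c d)
  then show ?case by (cases y) auto
qed

section \<open>Shapes, relabellings and interior rectangles\<close>

abbreviation shape :: "'a mexp \<Rightarrow> unit mexp" where
  "shape \<equiv> map_mexp (\<lambda>_. ())"

text \<open>Distinct letters make the relabelling well defined: those of the two factors are
  disjoint, so the relabellings of the factors can be glued.\<close>

lemma shape_eq_imp_map:
  assumes "shape s = shape t" "distinct (mexp_indets s)"
  shows "\<exists>f. t = map_mexp f s"
  using assms
proof (induction s arbitrary: t)
  case (Indet a)
  then obtain b where "t = Indet b" by (cases t) auto
  then show ?case by (auto intro: exI[of _ "\<lambda>_. b"])
next
  case (Circ s1 s2)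
  then obtain t1 t2 where t: "t = t1 \<^bold>\<circ> t2" by (cases t) auto
  with Circ obtain f g where "t1 = map_mexp f s1" "t2 = map_mexp g s2" by fastforce
  with t Circ.prems(2) show ?case
    by (intro exI[of _ "\<lambda>a. if a \<in> set_mexp s1 then f a else g a"])
      (auto simp: set_mexp_indets intro!: mexp.map_cong)
next
  case (Bullet s1 s2)
  then obtain t1 t2 where t: "t = t1 \<^bold>\<bullet> t2" by (cases t) auto
  with Bullet obtain f g where "t1 = map_mexp f s1" "t2 = map_mexp g s2" by fastforce
  with t Bullet.prems(2) show ?case
    by (intro exI[of _ "\<lambda>a. if a \<in> set_mexp s1 then f a else g a"])
      (auto simp: set_mexp_indets intro!: mexp.map_cong)
qed

text \<open>Reading \<open>\<circ>\<close> as vertical and \<open>\<bullet>\<close> as horizontal juxtaposition, the flags tell whether the top,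
  bottom, left and right side of the given rectangle lie on the boundary of the whole square.\<close>

fun inner :: "bool \<Rightarrow> bool \<Rightarrow> bool \<Rightarrow> bool \<Rightarrow> 'a mexp \<Rightarrow> 'a list" where
  "inner p q l r (Indet a) = (if p \<or> q \<or> l \<or> r then [] else [a])"
| "inner p q l r (s \<^bold>\<circ> t) = inner p False l r s @ inner False q l r t"
| "inner p q l r (s \<^bold>\<bullet> t) = inner p q l False s @ inner p q False r t"

abbreviation interior :: "'a mexp \<Rightarrow> 'a list" where
  "interior \<equiv> inner True True True True"

lemma inner_dual: "inner p q l r (dual s) = inner l r p q s"
  by (induction s arbitrary: p q l r) auto

text \<open>A cut clears just the flags of the sides it creates, so a letter omitted by
  \<open>inner\<close> lies on a flagged side of the whole and is read in the word of that
  side.\<close>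

lemma inner_or_boundary:
  "a \<in> set_mexp s \<Longrightarrow> a \<in> set (inner p q l r s) \<or> p \<and> a \<in> set (top_word s) \<or>
     q \<and> a \<in> set (bottom_word s) \<or> l \<and> a \<in> set (left_word s) \<or> r \<and> a \<in> set (right_word s)"
proof (induction s arbitrary: p q l r)
  case (Circ s t)
  then show ?case
    using Circ.IH(1)[of p False l r] Circ.IH(2)[of False q l r] by auto
next
  case (Bullet s t)
  then show ?case
    using Bullet.IH(1)[of p q l False] Bullet.IH(2)[of p q False r] by auto
qed auto

lemma left_word_map: "left_word (map_mexp f s) = map f (left_word s)"
  by (simp add: left_word_def word_map flip: map_dual)

lemma right_word_map: "right_word (map_mexp f s) = map f (right_word s)"
  by (simp add: right_word_def word_map flip: map_dual)

text \<open>The relabelling \<open>f\<close> from \<open>s\<close> to \<open>t\<close> permutes the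
  letters, because moves preserve their multiset, and fixes those in the four words, because these
  are invariant. A permutation moving \<open>a\<close> also moves \<open>f a\<close>, so two
  interior letters would be moved.\<close>

lemma rigid_if_interior_le_1:
  assumes "step\<^sup>*\<^sup>* s t" "normal s" "shape s = shape t" "distinct (mexp_indets s)"
    and "length (interior s) \<le> 1"
  shows "s = t"
proof -
  obtain f where t: "t = map_mexp f s" using shape_eq_imp_map[OF assms(3,4)] by blast
  note w = steps_words[OF assms(1,2)]
  have fixed: "f a = a" if "a \<in> set (top_word s) \<union> set (bottom_word s) \<union> set (left_word s) \<union> set (right_word s)" for a
  proof -
    have "map f (top_word s) = top_word s" "map f (bottom_word s) = bottom_word s"
      "map f (left_word s) = left_word s" "map f (right_word s) = right_word s"
      using w by (simp_all add: t word_map left_word_map right_word_map)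
    moreover have "\<forall>a\<in>set as. f a = a" if "map f as = as" for as
      using that by (induction as) auto
    ultimately show ?thesis using that by blast
  qed
  have image: "f ` set_mexp s = set_mexp s"
    using w by (metis mexp.set_map mset_eq_setD set_mexp_indets t)
  then have inj: "inj_on f (set_mexp s)"
    by (intro eq_card_imp_inj_on) (auto simp: set_mexp_indets)
  have "f a = a" if a: "a \<in> set_mexp s" for a
  proof (rule ccontr)
    assume ne: "f a \<noteq> a"
    have fa: "f a \<in> set_mexp s" using a image by blast
    have ne': "f (f a) \<noteq> f a" using inj_onD[OF inj _ fa a] ne by blast
    have "b \<in> set (interior s)" if "b \<in> set_mexp s" "f b \<noteq> b" for b
      using inner_or_boundary[OF that(1), of True True True True] fixed that(2) by blast
    then have "{a, f a} \<subseteq> set (interior s)" using a fa ne ne' by blast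
    then have "card {a, f a} \<le> length (interior s)"
      by (meson List.finite_set card_length card_mono le_trans)
    with ne assms(5) show False by auto
  qed
  then have "map_mexp f s = map_mexp id s" by (intro mexp.map_cong) auto
  then show ?thesis by (simp add: t mexp.map_id)
qed

section \<open>Exhaustive search\<close>

definition add_new :: "'a list \<Rightarrow> 'a list \<Rightarrow> 'a list \<Rightarrow> 'a list" where
  "add_new ds xs us = fold (\<lambda>x us. if x \<in> set ds then us else List.insert x us) xs us"

text \<open>Worklist search: \<open>ds\<close> is processed, the last argument is pending, and
  \<open>k\<close> bounds the number of expressions still to be processed. \<open>None\<close> means
  that the bound was hit, which \<open>rigid\<close> counts as failure.\<close>

fun explore :: "nat \<Rightarrow> 'a mexp list \<Rightarrow> 'a mexp list \<Rightarrow> 'a mexp list option" where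
  "explore k ds [] = Some ds"
| "explore 0 ds (u # us) = None"
| "explore (Suc k) ds (u # us) = explore k (u # ds) (add_new (u # ds) (nbrs u) us)"

lemma set_add_new: "set ds \<union> set (add_new ds xs us) = set ds \<union> set xs \<union> set us"
  unfolding add_new_def by (induction xs arbitrary: us) auto

text \<open>The invariant is that neighbours of processed expressions are processed or pending. Once
  nothing is pending, the processed ones are closed under moves.\<close>

lemma explore_closed:
  assumes "explore k ds us = Some vs" "\<forall>u\<in>set ds. set (nbrs u) \<subseteq> set ds \<union> set us"
  shows "set ds \<union> set us \<subseteq> set vs \<and> (\<forall>u\<in>set vs. set (nbrs u) \<subseteq> set vs)"
  using assms
proof (induction k ds us rule: explore.induct)
  case (3 k ds u us)
  have *: "set (u # ds) \<union> set (add_new (u # ds) (nbrs u) us) = set (u # ds) \<union> set (nbrs u) \<union> set us"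
    by (rule set_add_new)
  have "set (u # ds) \<union> set (add_new (u # ds) (nbrs u) us) \<subseteq> set vs \<and> (\<forall>u\<in>set vs. set (nbrs u) \<subseteq> set vs)"
  proof (rule 3(1))
    show "\<forall>v\<in>set (u # ds). set (nbrs v) \<subseteq> set (u # ds) \<union> set (add_new (u # ds) (nbrs u) us)"
      unfolding * using 3(3) by auto
  qed (use 3(2) in simp)
  then show ?case unfolding * by auto
qed auto

text \<open>The classes occurring below have at most 30 elements, so 40 rounds suffice.\<close>

definition rigid :: "'a mexp \<Rightarrow> bool" where
  "rigid s \<longleftrightarrow> (case explore 40 [] [s] of None \<Rightarrow> False
     | Some ts \<Rightarrow> list_all (\<lambda>t. if shape s = shape t then s = t else True) ts)"

text \<open>The explored list contains \<open>s\<close> and is closed under moves, so it contains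
  all that is reachable.\<close>

lemma rigidD:
  assumes "rigid s" "step\<^sup>*\<^sup>* s t" "shape s = shape t"
  shows "s = t"
proof -
  from assms(1) obtain ts where ts: "explore 40 [] [s] = Some ts"
    and all: "\<forall>t\<in>set ts. shape s = shape t \<longrightarrow> s = t"
    by (auto simp: rigid_def list_all_iff split: option.splits if_splits)
  from explore_closed[OF ts] have cl: "s \<in> set ts" "\<forall>u\<in>set ts. set (nbrs u) \<subseteq> set ts" by auto
  from assms(2) have "t \<in> set ts" by induction (use cl in auto)
  with all assms(3) show ?thesis by blast
qed

section \<open>Enumeration of normal forms with a given word\<close>

definition list_splits :: "'a list \<Rightarrow> ('a list \<times> 'a list) list" where
  "list_splits xs = map (\<lambda>i. (take i xs, drop i xs)) [1..<length xs]"

text \<open>The counter \<open>k\<close> makes the recursion structural; no normal form is lost once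
  it is at least the length of the word.\<close>

fun normals :: "nat \<Rightarrow> 'a list \<Rightarrow> 'a mexp list" where
  "normals 0 xs = []"
| "normals (Suc k) xs = (case xs of [a] \<Rightarrow> [Indet a] | _ \<Rightarrow>
     concat (map (\<lambda>(ys, zs). let ss = normals k ys; ts = normals k zs in
       concat (map (\<lambda>s. if is_circ s then [] else map (Circ s) ts) ss) @
       concat (map (\<lambda>s. if is_bullet s then [] else map (Bullet s) ts) ss)) (list_splits xs)))"

lemma mem_list_splits: "ys \<noteq> [] \<Longrightarrow> zs \<noteq> [] \<Longrightarrow> (ys, zs) \<in> set (list_splits (ys @ zs))"
  by (force simp: list_splits_def image_iff Suc_le_eq)

lemma normals_complete:
  "normal s \<Longrightarrow> length (mexp_indets s) \<le> k \<Longrightarrow> s \<in> set (normals k (mexp_indets s))"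
proof (induction s arbitrary: k)
  case (Indet a)
  then show ?case by (cases k) auto
next
  case (Circ s t)
  have len: "length (mexp_indets s) > 0" "length (mexp_indets t) > 0" by simp_all
  with Circ.prems(2) obtain k' where k: "k = Suc k'" by (cases k) auto
  with Circ.prems(2) len have "length (mexp_indets s) \<le> k'" "length (mexp_indets t) \<le> k'"
    unfolding mexp_indets.simps length_append by linarith+
  with Circ.IH Circ.prems(1) have "s \<in> set (normals k' (mexp_indets s))"
    "t \<in> set (normals k' (mexp_indets t))" by auto
  moreover obtain a b xs where "mexp_indets s @ mexp_indets t = a # b # xs"
    by (metis append_Cons append_Nil list.exhaust mexp_indets_not_Nil)
  ultimately show ?case
    using Circ.prems mem_list_splits[of "mexp_indets s" "mexp_indets t"]
    by (auto simp: k Let_def image_iff intro!: bexI[of _ "(mexp_indets s, mexp_indets t)"])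
next
  case (Bullet s t)
  have len: "length (mexp_indets s) > 0" "length (mexp_indets t) > 0" by simp_all
  with Bullet.prems(2) obtain k' where k: "k = Suc k'" by (cases k) auto
  with Bullet.prems(2) len have "length (mexp_indets s) \<le> k'" "length (mexp_indets t) \<le> k'"
    unfolding mexp_indets.simps length_append by linarith+
  with Bullet.IH Bullet.prems(1) have "s \<in> set (normals k' (mexp_indets s))"
    "t \<in> set (normals k' (mexp_indets t))" by auto
  moreover obtain a b xs where "mexp_indets s @ mexp_indets t = a # b # xs"
    by (metis append_Cons append_Nil list.exhaust mexp_indets_not_Nil)
  ultimately show ?case
    using Bullet.prems mem_list_splits[of "mexp_indets s" "mexp_indets t"]
    by (auto simp: k Let_def image_iff intro!: bexI[of _ "(mexp_indets s, mexp_indets t)"])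
qed

text \<open>In a normal form \<open>s \<circ> t\<close> the factor \<open>s\<close> is not a \<open>\<circ>\<close>-product, so the top word has at least
  two letters if and only if \<open>s\<close> is a \<open>\<bullet>\<close>-product.\<close>

definition all_rigid :: "nat \<Rightarrow> nat \<Rightarrow> bool" where
  "all_rigid i n \<longleftrightarrow> (let ts = filter (\<lambda>t. 2 \<le> length (bottom_word t)) (normals n [i..<n]) in
     list_all (\<lambda>s. if is_bullet s
         then list_all (\<lambda>t. if 2 \<le> length (interior (s \<^bold>\<circ> t)) then rigid (s \<^bold>\<circ> t) else True) ts
         else True) (normals n [0..<i]))"

text \<open>Verified by evaluation. Here \<open>n\<close> is the degree and \<open>i\<close> the
  number of letters in the first factor. A top word of at least two letters forces
  \<open>i \<ge> 2\<close>, a bottom word of at least two letters forces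
  \<open>i \<le> n - 2\<close>, and so \<open>n \<ge> 4\<close>.\<close>

lemma all_rigid_table: "list_all (\<lambda>n. list_all (\<lambda>i. all_rigid i n) [2..<n - 1]) [4..<9]"
  by code_simp

lemma length_word_le:
  "length (top_word s) \<le> length (mexp_indets s)" "length (bottom_word s) \<le> length (mexp_indets s)"
  by (induction s) auto

text \<open>The top word of a \<circ>-product is that of its first factor and the bottom word that
  of the rest, which puts the pair in the range of the table. The left and right words of a
  \<circ>-product have at least two letters automatically.\<close>

lemma rigid_critical:
  assumes "normal s" "is_circ s" "mexp_indets s = [0..<n]" "n \<le> 8"
    and "2 \<le> length (top_word s)" "2 \<le> length (bottom_word s)" "2 \<le> length (interior s)"
  shows "rigid s"
proof -
  obtain u v where s: "s = u \<^bold>\<circ> v" using assms(2) by (cases s) auto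
  define i where "i = length (mexp_indets u)"
  have "mexp_indets u = take i [0..<n]" "mexp_indets v = drop i [0..<n]"
    using assms(3) by (auto simp: s i_def simp flip: assms(3))
  moreover have i: "2 \<le> i" using length_word_le(1)[of u] assms(5) by (simp add: s i_def)
  moreover have i': "i + 2 \<le> n"
  proof -
    have "n = i + length (mexp_indets v)"
      using arg_cong[OF assms(3), of length] by (simp add: s i_def)
    with length_word_le(2)[of v] assms(6) show ?thesis by (simp add: s)
  qed
  ultimately have uv: "mexp_indets u = [0..<i]" "mexp_indets v = [i..<n]"
    by (simp_all add: take_upt)
  have "u \<in> set (normals n [0..<i])" "v \<in> set (normals n [i..<n])"
    using normals_complete[of u n] normals_complete[of v n] assms(1) i' by (auto simp: s uv)
  moreover have "is_bullet u" using assms(1,5) by (cases u) (auto simp: s)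
  moreover have "n \<in> set [4..<9]" "i \<in> set [2..<n - 1]" using i i' assms(4) by auto
  then have "all_rigid i n" using all_rigid_table unfolding list_all_iff by blast
  ultimately show ?thesis using assms(6,7) by (auto simp: all_rigid_def list_all_iff s)
qed

section \<open>Transfer from numbered to arbitrary letters\<close>

lemma splits_map:
  "circ_splits (map_mexp f s) = map (map_prod (map_mexp f) (map_mexp f)) (circ_splits s)"
  "bullet_splits (map_mexp f s) = map (map_prod (map_mexp f) (map_mexp f)) (bullet_splits s)"
  by (induction s) (auto simp: map_prod_def split_def)

lemma moves_map:
  "circ_moves (map_mexp f s) (map_mexp f t) = map (map_mexp f) (circ_moves s t)"
  "bullet_moves (map_mexp f s) (map_mexp f t) = map (map_mexp f) (bullet_moves s t)"
  by (simp_all add: circ_moves_def bullet_moves_def splits_map map_concat comp_def split_def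
      map_circ_app map_bullet_app)

text \<open>Moves depend on the tree alone and never compare letters, so they commute with
  relabelling.\<close>

lemma nbrs_map: "nbrs (map_mexp f s) = map (map_mexp f) (nbrs s)"
proof (induction s)
  case (Circ s t)
  then show ?case
    using moves_map(1)[of f s t]
    by (cases t) (simp_all add: comp_def map_circ_app moves_map)
next
  case (Bullet s t)
  then show ?case
    using moves_map(2)[of f s t]
    by (cases t) (simp_all add: comp_def map_bullet_app moves_map)
qed simp

lemma steps_map: "step\<^sup>*\<^sup>* s t \<Longrightarrow> step\<^sup>*\<^sup>* (map_mexp f s) (map_mexp f t)"
  by (induction rule: rtranclp_induct) (auto simp: nbrs_map elim!: rtranclp.rtrancl_into_rtrancl)

lemma normal_map [simp]: "normal (map_mexp f s) = normal s"
proof (induction s)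
  case (Circ s t) then show ?case by (cases s) auto
next
  case (Bullet s t) then show ?case by (cases s) auto
qed simp

lemma inner_map: "inner p q l r (map_mexp f s) = map f (inner p q l r s)"
  by (induction s arbitrary: p q l r) auto

lemma is_circ_map [simp]: "is_circ (map_mexp f s) = is_circ s"
  by (cases s) auto

lemma obtain_numbering:
  assumes "distinct xs"
  obtains f :: "'a \<Rightarrow> nat" where "map f xs = [0..<length xs]" "inj_on f (set xs)"
proof -
  define f where "f = the_inv_into {..<length xs} ((!) xs)"
  have "map f xs = [0..<length xs]"
    using assms by (auto intro!: nth_equalityI the_inv_into_f_f inj_on_nth simp: f_def)
  moreover from this have "inj_on f (set xs)" by (metis distinct_map distinct_upt)
  ultimately show thesis by (rule that)
qed

text \<open>Numbering the letters by position turns \<open>s\<close> into an entry of the table. The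
  equality is pulled back because the numbering is injective on the letters of \<open>s\<close>,
  which are also those of \<open>t\<close>.\<close>

lemma rigid_core_circ:
  assumes "normal s" "is_circ s" "distinct (mexp_indets s)" "length (mexp_indets s) \<le> 8"
    and "2 \<le> length (top_word s)" "2 \<le> length (bottom_word s)" "2 \<le> length (interior s)"
    and "step\<^sup>*\<^sup>* s t" "shape s = shape t"
  shows "s = t"
proof -
  obtain f :: "'a \<Rightarrow> nat" where f: "map f (mexp_indets s) = [0..<length (mexp_indets s)]"
    "inj_on f (set (mexp_indets s))"
    using obtain_numbering[OF assms(3)] .
  have "rigid (map_mexp f s)"
    using assms f(1) by (intro rigid_critical[of _ "length (mexp_indets s)"])
      (simp_all add: mexp_indets_map word_map inner_map)
  moreover have "shape (map_mexp f s) = shape (map_mexp f t)"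
    using assms(9) by (simp add: mexp.map_comp comp_def)
  ultimately have "map_mexp f s = map_mexp f t"
    using rigidD steps_map[OF assms(8)] by blast
  moreover have "set_mexp t = set_mexp s"
    using steps_words[OF assms(8,1)] by (metis mset_eq_setD set_mexp_indets)
  ultimately show ?thesis
    using f(2) by (metis mexp.inj_map_strong inj_onD set_mexp_indets)
qed

text \<open>The top word excludes a single indeterminate, so \<open>s\<close> or its dual is a
  \<circ>-product. Top and bottom words of the dual are the left and right words of
  \<open>s\<close>.\<close>

lemma rigid_core:
  assumes "normal s" "distinct (mexp_indets s)" "length (mexp_indets s) \<le> 8"
    and "2 \<le> length (top_word s)" "2 \<le> length (bottom_word s)"
    and "2 \<le> length (left_word s)" "2 \<le> length (right_word s)" "2 \<le> length (interior s)"
    and "step\<^sup>*\<^sup>* s t" "shape s = shape t"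
  shows "s = t"
proof (cases "is_circ s")
  case True
  with rigid_core_circ assms show ?thesis by blast
next
  case False
  with assms(4) have circ: "is_circ (dual s)" by (cases s) auto
  have "dual s = dual t"
    by (rule rigid_core_circ)
      (use assms circ steps_dual[OF assms(9)] in
        \<open>simp_all add: inner_dual map_dual left_word_def right_word_def\<close>)
  then show ?thesis by simp
qed

section \<open>Induction on the degree\<close>

lemma steps_Indet: "step\<^sup>*\<^sup>* (Indet a) t \<Longrightarrow> t = Indet a"
  by (induction rule: rtranclp_induct) auto

text \<open>The induction hypothesis is a premise so that the lemma can serve for \<open>s\<close>
  and for its dual. Removing the single rectangle gives a smaller instance, to which moves and
  shapes restrict.\<close>

lemma peel:
  fixes s t :: "'a mexp"
  assumes IH: "\<And>u v :: 'a mexp. length (mexp_indets u) < length (mexp_indets s) \<Longrightarrow> normal u \<Longrightarrow>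
      distinct (mexp_indets u) \<Longrightarrow> step\<^sup>*\<^sup>* u v \<Longrightarrow> shape u = shape v \<Longrightarrow> u = v"
    and s: "normal s" "distinct (mexp_indets s)" "step\<^sup>*\<^sup>* s t" "shape s = shape t"
    and single: "length (top_word s) = 1 \<or> length (bottom_word s) = 1"
  shows "s = t"
proof -
  consider a where "s = Indet a" | a u where "s = Indet a \<^bold>\<circ> u"
    | a u where "normal u" "s = circ_app u (Indet a)"
    using single top_word_single[OF s(1)] bottom_word_single[OF s(1)] by blast
  then show ?thesis
  proof cases
    case 1
    with s(3) steps_Indet show ?thesis by metis
  next
    case 2
    from steps_peel_first[OF s(3)[unfolded 2]]
    obtain v where v: "t = Indet a \<^bold>\<circ> v" "step\<^sup>*\<^sup>* u v" by blast
    have len: "length (mexp_indets u) < length (mexp_indets s)" by (simp add: 2)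
    have u: "normal u" "distinct (mexp_indets u)" using s(1,2) by (simp_all add: 2)
    have "shape u = shape v" using s(4) by (simp add: 2 v(1))
    then have "u = v" by (rule IH[OF len u v(2)])
    then show ?thesis by (simp add: 2 v(1))
  next
    case 3
    from steps_peel_last[OF s(3)[unfolded 3(2)] 3(1)]
    obtain v where v: "t = circ_app v (Indet a)" "step\<^sup>*\<^sup>* u v" by blast
    have len: "length (mexp_indets u) < length (mexp_indets s)" by (simp add: 3(2))
    have u: "distinct (mexp_indets u)" using s(2) by (simp add: 3(2))
    have *: "shape (circ_app u (Indet a)) = shape (circ_app v (Indet a))"
      using s(4) by (simp only: 3(2) v(1))
    have "shape u = shape v"
      using * by (simp add: map_circ_app circ_app_Indet_cancel)
    then have "u = v" by (rule IH[OF len 3(1) u v(2)])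
    then show ?thesis by (simp only: 3(2) v(1))
  qed
qed

text \<open>The induction serves the removal of a rectangle that fills a side; the other two cases
  are settled outright by the boundary words or by the table.\<close>

lemma steps_rigid:
  assumes "normal s" "distinct (mexp_indets s)" "length (mexp_indets s) \<le> 8"
    and "step\<^sup>*\<^sup>* s t" "shape s = shape t"
  shows "s = t"
  using assms
proof (induction "length (mexp_indets s)" arbitrary: s t rule: less_induct)
  case less
  have IH: "u = v" if "length (mexp_indets u) < length (mexp_indets s)" "normal u"
    "distinct (mexp_indets u)" "step\<^sup>*\<^sup>* u v" "shape u = shape v" for u v :: "'a mexp"
    using that less.hyps[of u v] less.prems(3) by simp
  consider "length (top_word s) = 1 \<or> length (bottom_word s) = 1"
    | "length (left_word s) = 1 \<or> length (right_word s) = 1" | "length (interior s) \<le> 1"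
    | "2 \<le> length (top_word s)" "2 \<le> length (bottom_word s)" "2 \<le> length (left_word s)"
      "2 \<le> length (right_word s)" "2 \<le> length (interior s)"
  proof -
    have "length (top_word s) \<noteq> 0" "length (bottom_word s) \<noteq> 0"
      "length (left_word s) \<noteq> 0" "length (right_word s) \<noteq> 0"
      by (simp_all add: left_word_def right_word_def)
    then show thesis using that by linarith
  qed
  then show ?case
  proof cases
    case 1
    then show ?thesis using peel[OF IH] less.prems by blast
  next
    case 2
    \<comment> \<open>A rectangle filling the left or right side fills the top or bottom side of the
      dual.\<close>
    have "dual s = dual t"
      by (rule peel)
        (use IH less.prems steps_dual[OF less.prems(4)] 2 in
          \<open>simp_all add: map_dual left_word_def right_word_def\<close>)
    then show ?thesis by simp
  next
    case 3
    then show ?thesis using rigid_if_interior_le_1 less.prems by blast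
  next
    case 4
    then show ?thesis using rigid_core less.prems by blast
  qed
qed

section \<open>Walks\<close>

lemma normal_form_inject: "normal_form m = normal_form m' \<longleftrightarrow> m = m'"
  by (metis abs_normal_form)

lemma shape_normal_form: "shape (normal_form m) = normal_form (assoc_type m)"
  by (simp add: assoc_type_def normal_form_rename)

lemma interchanges_rigid:
  assumes "interchange\<^sup>*\<^sup>* m m'" "multilinear n m" "n \<le> 8" "assoc_type m = assoc_type m'"
  shows "m = m'"
proof -
  have "step\<^sup>*\<^sup>* (normal_form m) (normal_form m')"
    using assms(1)
    by (induction rule: rtranclp_induct)
      (auto intro: rtranclp.rtrancl_into_rtrancl step_normal_form)
  then have "normal_form m = normal_form m'"
    by (rule steps_rigid[rotated 3])
      (use assms multilinear_degree[OF assms(2)] in \<open>simp_all add: normal_normal_form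
        indets_normal_form shape_normal_form multilinear_def degree_def\<close>)
  then show ?thesis by (simp add: normal_form_inject)
qed

section \<open>Transitivity on fibres and lifting of walks\<close>

lemma assoc_type_eq_imp_rename:
  assumes "multilinear n m" "multilinear n m'" "assoc_type m = assoc_type m'"
  obtains \<tau> where "\<tau> permutes {..<n}" "m' = rename \<tau> m"
proof -
  have "shape (normal_form m) = shape (normal_form m')"
    using assms(3) by (simp add: shape_normal_form)
  then obtain f where f: "normal_form m' = map_mexp f (normal_form m)"
    using shape_eq_imp_map assms(1) by (metis indets_normal_form multilinear_def)
  then have "m' = rename f m" by (simp flip: normal_form_rename add: normal_form_inject)
  then have "indets m' = map f (indets m)" by (simp add: indets_rename)
  with assms have bij: "bij_betw f {..<n} {..<n}"
    unfolding multilinear_def bij_betw_def by (metis distinct_map list.set_map)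
  \<comment> \<open>\<open>f\<close> is controlled only on the letters, whereas
    \<open>permutes\<close> requires the identity elsewhere.\<close>
  define \<tau> where "\<tau> = (\<lambda>k. if k < n then f k else k)"
  have "bij_betw \<tau> {..<n} {..<n}" using bij bij_betw_cong[of "{..<n}" \<tau> f] by (simp add: \<tau>_def)
  then have "\<tau> permutes {..<n}" by (rule bij_imp_permutes) (simp add: \<tau>_def)
  moreover have "normal_form m' = map_mexp \<tau> (normal_form m)"
    unfolding f using assms(1)
    by (intro mexp.map_cong) (auto simp: \<tau>_def set_mexp_indets indets_normal_form multilinear_def)
  then have "m' = rename \<tau> m" by (simp flip: normal_form_rename add: normal_form_inject)
  ultimately show thesis by (rule that)
qed

lemma ex_labelling:
  "length xs = length (mexp_indets s) \<Longrightarrow> \<exists>t. mexp_indets t = xs \<and> shape t = shape s"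
proof (induction s arbitrary: xs)
  case (Indet a)
  then obtain x where "xs = [x]" by (auto simp: length_Suc_conv)
  then show ?case by (intro exI[of _ "Indet x"]) simp
next
  case (Circ s1 s2)
  let ?k = "length (mexp_indets s1)"
  obtain t1 t2 where "mexp_indets t1 = take ?k xs" "shape t1 = shape s1"
    "mexp_indets t2 = drop ?k xs" "shape t2 = shape s2"
    using Circ.IH(1)[of "take ?k xs"] Circ.IH(2)[of "drop ?k xs"] Circ.prems by auto
  then show ?case by (intro exI[of _ "t1 \<^bold>\<circ> t2"]) simp
next
  case (Bullet s1 s2)
  let ?k = "length (mexp_indets s1)"
  obtain t1 t2 where "mexp_indets t1 = take ?k xs" "shape t1 = shape s1"
    "mexp_indets t2 = drop ?k xs" "shape t2 = shape s2"
    using Bullet.IH(1)[of "take ?k xs"] Bullet.IH(2)[of "drop ?k xs"] Bullet.prems by auto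
  then show ?case by (intro exI[of _ "t1 \<^bold>\<bullet> t2"]) simp
qed

text \<open>Surjectivity of the covering on vertices: the positions are filled with
  \<open>0, ..., n - 1\<close> in order.\<close>

lemma ex_multilinear:
  assumes "degree T = n"
  obtains m where "multilinear n m" "assoc_type m = T"
proof -
  obtain t where t: "mexp_indets t = [0..<n]" "shape t = shape (normal_form T)"
    using ex_labelling[of "[0..<n]" "normal_form T"] assms
    by (auto simp: indets_normal_form degree_def)
  have "shape s = s" for s :: "unit mexp" by (induction s) simp_all
  with t have "assoc_type (abs_monomial t) = T"
    by (simp add: assoc_type_def rename.abs_eq abs_normal_form)
  moreover have "multilinear n (abs_monomial t)"
    using t(1) by (auto simp: multilinear_def indets.abs_eq)
  ultimately show thesis using that by blast
qed

lemma F_walk_interchanges: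
  assumes "pre_digraph.cas (F n) m p m'" "set p \<subseteq> arcs (F n)"
  shows "interchange\<^sup>*\<^sup>* m m'"
  using assms
proof (induction p arbitrary: m)
  case Nil
  then show ?case by (simp add: pre_digraph.cas.simps)
next
  case (Cons e p)
  then have "interchange m (snd e)" "interchange\<^sup>*\<^sup>* (snd e) m'"
    by (auto simp: pre_digraph.cas.simps F_def)
  then show ?case by (rule converse_rtranclp_into_rtranclp)
qed

text \<open>Path lifting for the covering, from any chosen starting point \<open>m\<close> over
  \<open>T\<close>. Labels of the form \<open>inv \<sigma> \<circ> \<sigma>'\<close> telescope, so
  the label product is what carries the initial underlying permutation to the final one.\<close>

lemma G_walk_lift:
  assumes "pre_digraph.cas (G n) T p T'" "set p \<subseteq> arcs (G n)" "multilinear n m" "assoc_type m = T"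
  shows "\<exists>m'. multilinear n m' \<and> assoc_type m' = T' \<and> interchange\<^sup>*\<^sup>* m m' \<and>
    underlying_perm m' = underlying_perm m \<circ> path_perm p"
  using assms
proof (induction p arbitrary: T m)
  case Nil
  then show ?case by (auto simp: pre_digraph.cas.simps path_perm_def)
next
  case (Cons E p)
  from Cons.prems(2) obtain a b where ab: "(a, b) \<in> arcs (F n)" and E: "E = arc_orbit n (a, b)"
    by (auto simp: G_def)
  then have a: "multilinear n a" and b: "multilinear n b" and "interchange a b"
    by (auto simp: F_def)
  from Cons.prems(1) have tail: "assoc_type a = T" and cas: "pre_digraph.cas (G n) (assoc_type b) p T'"
    by (simp_all add: pre_digraph.cas.simps E arc_orbit_ends)
  \<comment> \<open>The representative \<open>(a, b)\<close> of the arc need not start at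
    \<open>m\<close>; a renaming \<open>\<tau>\<close> moves it there and preserves its
    label.\<close>
  obtain \<tau> where \<tau>: "\<tau> permutes {..<n}" and m: "m = rename \<tau> a"
    using assoc_type_eq_imp_rename[OF a Cons.prems(3)] tail Cons.prems(4) by metis
  have "interchange m (rename \<tau> b)"
    unfolding m by (rule interchange_rename) fact
  moreover have "set p \<subseteq> arcs (G n)" using Cons.prems(2) by simp
  from Cons.IH[OF cas this multilinear_rename[OF b \<tau>] assoc_type_rename] obtain m' where
    "multilinear n m'" "assoc_type m' = T'" "interchange\<^sup>*\<^sup>* (rename \<tau> b) m'"
    "underlying_perm m' = underlying_perm (rename \<tau> b) \<circ> path_perm p" by blast
  moreover have "underlying_perm (rename \<tau> b) = underlying_perm m \<circ> arc_label E"
    using permutes_inv_o(1)[OF underlying_perm_permutes[OF a]]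
    by (simp add: E arc_label_orbit[OF ab] m underlying_perm_rename[OF a \<tau>]
        underlying_perm_rename[OF b \<tau>] comp_assoc flip: comp_assoc[of "underlying_perm a"])
  ultimately show ?case
    by (intro exI[of _ m'])
      (auto simp: path_perm_def comp_assoc intro: converse_rtranclp_into_rtranclp)
qed

theorem proposition3p4:
  fixes n :: nat
  assumes "1 \<le> n" and "n \<le> 8"
  shows "(\<forall>T p. pre_digraph.awalk (G n) T p T \<longrightarrow> path_perm p = id) \<and>
    (\<forall>m m' p. pre_digraph.awalk (F n) m p m' \<longrightarrow> assoc_type m = assoc_type m' \<longrightarrow> m = m')"
proof (intro conjI allI impI)
  fix T p
  assume "pre_digraph.awalk (G n) T p T"
  then have T: "degree T = n" and p: "pre_digraph.cas (G n) T p T" "set p \<subseteq> arcs (G n)"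
    by (auto simp: pre_digraph.awalk_def G_def)
  from T obtain m where m: "multilinear n m" "assoc_type m = T" by (rule ex_multilinear)
  from G_walk_lift[OF p m] obtain m' where m': "assoc_type m' = T" "interchange\<^sup>*\<^sup>* m m'"
    "underlying_perm m' = underlying_perm m \<circ> path_perm p" by blast
  \<comment> \<open>The lift ends over \<open>T\<close> again, so rigidity closes it.\<close>
  with m assms(2) have "m' = m" by (metis interchanges_rigid)
  \<comment> \<open>Cancelling the underlying permutation of \<open>m\<close> isolates the label
    product.\<close>
  with m'(3) have "inv (underlying_perm m) \<circ> underlying_perm m
      = (inv (underlying_perm m) \<circ> underlying_perm m) \<circ> path_perm p"
    by (simp add: comp_assoc)
  then show "path_perm p = id"
    by (simp add: permutes_inv_o(2)[OF underlying_perm_permutes[OF m(1)]])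
next
  fix m m' p
  assume "pre_digraph.awalk (F n) m p m'" "assoc_type m = assoc_type m'"
  then show "m = m'"
    using F_walk_interchanges interchanges_rigid[OF _ _ assms(2)]
    by (auto simp: pre_digraph.awalk_def F_def)
qed

end
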